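(* Let $I$ be a composition of $n$. Then in $\mathbf{Sym}$, $$R_I=\sum_{J\vDash n}K_{IJ}\,\Psi_J,$$ where $K_{IJ}$ is the number of packed words $u$ of length $n$ satisfying $\operatorname{D}(u)=I$ and $\operatorname{WC}(u)=J$. In particular, the $K_{IJ}$ are nonnegative integers.
   Context: $\mathbf{Sym}$ is the free associative algebra over a field $\mathbb{K}$ of characteristic zero on noncommuting generators $S_1,S_2,\dots$, $\deg S_n=n$, with $S_0=1$. For a composition $I=(i_1,\dots,i_r)$, $S^I=S_{i_1}\cdots S_{i_r}$, and the ribbon basis is $R_I=\sum_J(-1)^{l(I)-l(J)}S^J$, summed over compositions $J$ coarser than or equal to $I$ (obtained by summing consecutive parts of $I$); $l(\cdot)$ is the number of parts. The noncommutative power sums of the first kind $\Psi_n$ are defined by $nS_n=\sum_{k=0}^{n-1}S_k\Psi_{n-k}$, and for a composition $(i_1,\dots,i_r)$ the noncommutative monomial functions are defined recursively by $\Psi_\emptyset=1$, $\Psi_{(n)}=\Psi_n$ and $$r\,\Psi_{(i_1,\dots,i_r)}=\sum_{s=1}^{r}(-1)^{s-1}\Psi_{i_1+\dots+i_s}\,\Psi_{(i_{s+1},\dots,i_r)}.$$ A word over the positive integers is packed if its set of letters is $\{1,\dots,r\}$ for some $r$. For a word $u=u_1\cdots u_n$, $\operatorname{D}(u)$ is the composition of $n$ whose set of proper partial sums is $\{i: u_i>u_{i+1}\}$. The W-composition $\operatorname{WC}(u)$ of a packed word $u$ of length $n$ is the composition $(k_1,\dots,k_r)$ of $n$ whose set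 of partial sums $\{k_1,\dots,k_1+\dots+k_r\}$ is the set of positions of the last occurrences of the letters of $u$ (e.g. $\operatorname{WC}(1543421323)=(2,3,2,2,1)$). *)

theory Defs
  imports Complex_Main "HOL-Library.Poly_Mapping"
begin

typedef composition = "{xs :: nat list. 0 \<notin> set xs}"
  morphisms parts Composition
  by (rule exI[of _ "[]"]) simp

text \<open>Under concatenation, compositions form the free monoid on the positive integers.\<close>

instantiation composition :: monoid_add
begin

definition zero_composition :: composition where
  "0 = Composition []"

definition plus_composition :: "composition \<Rightarrow> composition \<Rightarrow> composition" where
  "I + J = Composition (parts I @ parts J)"

lemma parts_zero: "parts 0 = []"
  by (simp add: zero_composition_def Composition_inverse)

lemma parts_plus: "parts (I + J) = parts I @ parts J"
  using parts[of I] parts[of J] by (simp add: plus_composition_def Composition_inverse)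

instance
  by standard (simp_all add: parts_inject[symmetric] parts_plus parts_zero)

end

definition weight :: "composition \<Rightarrow> nat" where
  "weight I = sum_list (parts I)"

definition len :: "composition \<Rightarrow> nat" where
  "len I = length (parts I)"

definition compositions :: "nat \<Rightarrow> composition set" where
  "compositions n = {I. weight I = n}"

lemma length_le_sum_list: "0 \<notin> set xs \<Longrightarrow> length xs \<le> sum_list (xs :: nat list)"
  by (induction xs) auto

lemma finite_compositions: "finite (compositions n)"
proof (rule finite_imageD[where f = parts])
  have "parts ` compositions n \<subseteq> {xs. set xs \<subseteq> {..n} \<and> length xs \<le> n}"
    using parts length_le_sum_list member_le_sum_list
    by (fastforce simp: compositions_def weight_def)
  then show "finite (parts ` compositions n)"
    by (rule finite_subset) (simp add: finite_lists_length_le)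
  show "inj_on parts (compositions n)"
    by (simp add: inj_on_def parts_inject)
qed

definition partial_sums :: "composition \<Rightarrow> nat set" where
  "partial_sums I = {sum_list (take j (parts I)) | j. 1 \<le> j \<and> j \<le> len I}"

definition proper_partial_sums :: "composition \<Rightarrow> nat set" where
  "proper_partial_sums I = {sum_list (take j (parts I)) | j. 1 \<le> j \<and> j < len I}"

text \<open>\<open>coarser J I\<close>: \<open>J\<close> is coarser than or equal to \<open>I\<close>, that is, \<open>parts I\<close> splits into
  nonempty consecutive blocks whose sums are the parts of \<open>J\<close>.\<close>

definition coarser :: "composition \<Rightarrow> composition \<Rightarrow> bool" where
  "coarser J I \<longleftrightarrow>
     (\<exists>xss. [] \<notin> set xss \<and> concat xss = parts I \<and> map sum_list xss = parts J)"

lemma finite_coarser: "finite {J. coarser J I}"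
proof (rule finite_subset[OF _ finite_compositions[of "weight I"]])
  have "sum_list (map sum_list xss) = sum_list (concat xss)" for xss :: "nat list list"
    by (induction xss) auto
  then show "{J. coarser J I} \<subseteq> compositions (weight I)"
    by (auto simp: coarser_def compositions_def weight_def) metis
qed

text \<open>The free associative algebra on \<open>S\<^sub>1, S\<^sub>2, \<dots>\<close> is the monoid algebra of the free monoid on
  the positive integers, with the convolution product of \<^theory>\<open>HOL-Library.Poly_Mapping\<close>.\<close>

type_synonym 'k sym = "composition \<Rightarrow>\<^sub>0 'k"

definition scale :: "'k \<Rightarrow> 'k sym \<Rightarrow> 'k::field_char_0 sym" where
  "scale c x = Poly_Mapping.single 0 c * x"

definition S :: "nat \<Rightarrow> 'k::field_char_0 sym" where
  "S n = (if n = 0 then 1 else Poly_Mapping.single (Composition [n]) 1)"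

definition S_comp :: "composition \<Rightarrow> 'k::field_char_0 sym" where
  "S_comp I = prod_list (map S (parts I))"

definition ribbon :: "composition \<Rightarrow> 'k::field_char_0 sym" where
  "ribbon I = (\<Sum>J | coarser J I. (-1) ^ (len I - len J) * S_comp J)"

text \<open>The power sums of the first kind; \<open>psi_recursion\<close> below is the usual defining relation.\<close>

function psi :: "nat \<Rightarrow> 'k::field_char_0 sym" where
  "psi n = of_nat n * S n - (\<Sum>k\<in>{1..<n}. S k * psi (n - k))"
  by auto
termination by (relation "measure id") auto

declare psi.simps [simp del]

lemma psi_recursion:
  assumes "n \<ge> 1"
  shows "of_nat n * S n = (\<Sum>k=0..<n. S k * psi (n - k) :: 'k::field_char_0 sym)"
proof -
  have "(\<Sum>k=0..<n. S k * psi (n - k) :: 'k sym) = psi n + (\<Sum>k\<in>{1..<n}. S k * psi (n - k))"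
    using assms by (subst sum.atLeast_Suc_lessThan) (auto simp: S_def)
  also have "\<dots> = of_nat n * S n"
    by (subst psi.simps) simp
  finally show ?thesis ..
qed

function Psi_list :: "nat list \<Rightarrow> 'k::field_char_0 sym" where
  "Psi_list is = (if is = [] then 1 else
     scale (1 / of_nat (length is))
       (\<Sum>s\<in>{1..length is}. (-1) ^ (s - 1) * psi (sum_list (take s is)) * Psi_list (drop s is)))"
  by auto
termination by (relation "measure length") auto

declare Psi_list.simps [simp del]

definition Psi :: "composition \<Rightarrow> 'k::field_char_0 sym" where
  "Psi I = Psi_list (parts I)"

lemma Psi_zero: "Psi 0 = 1"
  by (simp add: Psi_def parts_zero Psi_list.simps)

lemma scale_inverse_of_nat:
  assumes "r \<noteq> 0"
  shows "of_nat r * scale (1 / of_nat r) x = (x :: 'k::field_char_0 sym)"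
proof -
  have "(of_nat r :: 'k sym) = Poly_Mapping.single 0 (of_nat r)"
    by simp
  then show ?thesis
    using assms by (simp add: scale_def mult.assoc[symmetric] mult_single del: single_of_nat)
qed

lemma Psi_list_recursion:
  assumes "is \<noteq> []"
  shows "of_nat (length is) * Psi_list is =
    (\<Sum>s=1..length is. (-1) ^ (s - 1) * psi (sum_list (take s is)) * Psi_list (drop s is)
       :: 'k::field_char_0 sym)"
  using assms by (subst Psi_list.simps) (simp add: scale_inverse_of_nat)

lemma Psi_list_single: "Psi_list [n] = (psi n :: 'k::field_char_0 sym)"
  using Psi_list_recursion[of "[n]", where 'k = 'k]
  by (simp add: Psi_list.simps[of "[]"])

definition packed :: "nat list \<Rightarrow> bool" where
  "packed u \<longleftrightarrow> (\<exists>r. set u = {1..r})"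

text \<open>Words are lists, indexed from 0, whereas positions in words are counted from 1.\<close>

definition descents :: "nat list \<Rightarrow> nat set" where
  "descents u = {i. 1 \<le> i \<and> i < length u \<and> u ! (i - 1) > u ! i}"

definition last_positions :: "nat list \<Rightarrow> nat set" where
  "last_positions u =
     {i. 1 \<le> i \<and> i \<le> length u \<and> (\<forall>j. i < j \<and> j \<le> length u \<longrightarrow> u ! (j - 1) \<noteq> u ! (i - 1))}"

definition psums :: "nat list \<Rightarrow> nat set" where
  "psums xs = {sum_list (take j xs) | j. 1 \<le> j \<and> j \<le> length xs}"

lemma psums_eq_image: "psums xs = (\<lambda>j. sum_list (take j xs)) ` {1..length xs}"
  by (auto simp: psums_def)

lemma psums_Nil: "psums [] = {}"
  by (simp add: psums_def)

lemma psums_Cons: "psums (x # xs) = insert x ((+) x ` psums xs)"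
proof -
  have "{1..length (x # xs)} = insert 1 (Suc ` {1..length xs})"
    by (auto simp: image_iff)
  then show ?thesis
    unfolding psums_eq_image by (simp only: image_insert image_image) simp
qed

lemma psums_snoc: "psums (xs @ [k]) = insert (sum_list xs + k) (psums xs)"
  by (induction xs) (auto simp: psums_Cons psums_Nil add.assoc image_image)

lemma psums_pos: "0 \<notin> set xs \<Longrightarrow> 0 \<notin> psums xs"
  by (induction xs) (auto simp: psums_Cons psums_Nil)

lemma psums_inj:
  assumes "0 \<notin> set xs" "0 \<notin> set ys" "psums xs = psums ys"
  shows "xs = ys"
  using assms
proof (induction xs arbitrary: ys)
  case Nil
  then show ?case by (cases ys) (auto simp: psums_Nil psums_Cons)
next
  case (Cons x xs)
  then obtain y zs where ys: "ys = y # zs"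
    by (cases ys) (auto simp: psums_Nil psums_Cons)
  have pos: "0 \<notin> psums xs" "0 \<notin> psums zs"
    using Cons.prems ys psums_pos by auto
  have eq: "insert x ((+) x ` psums xs) = insert y ((+) y ` psums zs)"
    using Cons.prems ys by (simp add: psums_Cons)
  then have "x \<in> insert y ((+) y ` psums zs)" "y \<in> insert x ((+) x ` psums xs)"
    by blast+
  then have "x = y" by auto
  moreover have "(+) x ` psums xs = (+) x ` psums zs"
  proof -
    have "x \<notin> (+) x ` psums xs" "x \<notin> (+) x ` psums zs"
      using pos by auto
    then show ?thesis using eq \<open>x = y\<close> by (metis insert_ident)
  qed
  then have "psums xs = psums zs"
    by (simp add: inj_image_eq_iff)
  ultimately show ?case
    using Cons ys by auto
qed

lemma psums_exists:
  assumes "finite A" "0 \<notin> A"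
  shows "\<exists>xs. 0 \<notin> set xs \<and> psums xs = A \<and> sum_list xs = Max (insert 0 A)"
  using assms
proof (induction rule: finite_linorder_max_induct)
  case empty
  show ?case by (rule exI[of _ "[]"]) (simp add: psums_Nil)
next
  case (insert b A)
  then obtain xs where xs: "0 \<notin> set xs" "psums xs = A" "sum_list xs = Max (insert 0 A)"
    by auto
  have lt: "sum_list xs < b"
    using insert xs by (simp add: Max_less_iff)
  have "Max (insert 0 (insert b A)) = b"
    using insert by (intro Max_eqI) (auto simp: less_imp_le)
  then show ?case
    using xs lt by (intro exI[of _ "xs @ [b - sum_list xs]"]) (auto simp: psums_snoc)
qed

lemma partial_sums_eq: "partial_sums I = psums (parts I)"
  by (simp add: partial_sums_def psums_def len_def)

lemma proper_partial_sums_eq: "proper_partial_sums I = psums (butlast (parts I))"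
  unfolding proper_partial_sums_def psums_def len_def
  by (force simp: take_butlast)

lemma ex1_WC: "\<exists>!J. J \<in> compositions (length u) \<and> partial_sums J = last_positions u"
proof (rule ex_ex1I)
  have sub: "last_positions u \<subseteq> {1..length u}"
    by (auto simp: last_positions_def)
  then have "finite (last_positions u)" "0 \<notin> last_positions u"
    by (auto intro: finite_subset)
  moreover have "Max (insert 0 (last_positions u)) = length u"
    using sub by (intro Max_eqI finite.insertI finite_subset[OF sub]) (auto simp: last_positions_def Suc_le_eq)
  ultimately obtain xs where "0 \<notin> set xs" "psums xs = last_positions u" "sum_list xs = length u"
    using psums_exists by metis
  then show "\<exists>J. J \<in> compositions (length u) \<and> partial_sums J = last_positions u"
    by (intro exI[of _ "Composition xs"])
      (simp add: compositions_def weight_def partial_sums_eq Composition_inverse)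
next
  fix I J
  assume "I \<in> compositions (length u) \<and> partial_sums I = last_positions u"
    and "J \<in> compositions (length u) \<and> partial_sums J = last_positions u"
  then show "I = J"
    using psums_inj[of "parts I" "parts J"] parts[of I] parts[of J]
    by (simp add: partial_sums_eq parts_inject)
qed

lemma ex1_D: "\<exists>!I. I \<in> compositions (length u) \<and> proper_partial_sums I = descents u"
proof (cases "u = []")
  case True
  have "sum_list xs = 0 \<longleftrightarrow> xs = []" if "0 \<notin> set xs" for xs :: "nat list"
    using that by (cases xs) auto
  then have "I \<in> compositions 0 \<longleftrightarrow> parts I = []" for I
    using parts[of I] unfolding compositions_def weight_def by blast
  moreover have "parts I = [] \<longleftrightarrow> I = 0" for I
    by (metis parts_inject parts_zero)
  ultimately show ?thesis
    using True by (auto simp: proper_partial_sums_eq descents_def parts_zero psums_Nil)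
next
  case False
  show ?thesis
  proof (rule ex_ex1I)
    have sub: "descents u \<subseteq> {1..<length u}"
      by (auto simp: descents_def)
    then have "finite (descents u)" "0 \<notin> descents u"
      by (auto intro: finite_subset)
    moreover from this have "Max (insert 0 (descents u)) < length u"
      using sub False by auto
    ultimately obtain xs where xs: "0 \<notin> set xs" "psums xs = descents u" "sum_list xs < length u"
      using psums_exists by metis
    then show "\<exists>I. I \<in> compositions (length u) \<and> proper_partial_sums I = descents u"
      by (intro exI[of _ "Composition (xs @ [length u - sum_list xs])"])
        (simp add: compositions_def weight_def proper_partial_sums_eq Composition_inverse)
  next
    fix I J
    assume I: "I \<in> compositions (length u) \<and> proper_partial_sums I = descents u"
      and J: "J \<in> compositions (length u) \<and> proper_partial_sums J = descents u"
    have "0 \<notin> set (butlast (parts I))" "0 \<notin> set (butlast (parts J))"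
      using parts[of I] parts[of J] by (auto dest: in_set_butlastD)
    then have bl: "butlast (parts I) = butlast (parts J)"
      using I J psums_inj by (simp add: proper_partial_sums_eq)
    have ne: "parts I \<noteq> []" "parts J \<noteq> []"
      using I J False by (auto simp: compositions_def weight_def)
    have "sum_list (butlast (parts I)) + last (parts I) = length u"
      "sum_list (butlast (parts J)) + last (parts J) = length u"
      using I J ne by (metis (mono_tags, lifting) append_butlast_last_id compositions_def
          mem_Collect_eq sum_list.Cons sum_list.Nil sum_list.append add_0_right weight_def)+
    then have "last (parts I) = last (parts J)"
      using bl by simp
    then show "I = J"
      using bl ne by (metis append_butlast_last_id parts_inject)
  qed
qed

definition D :: "nat list \<Rightarrow> composition" where
  "D u = (THE I. I \<in> compositions (length u) \<and> proper_partial_sums I = descents u)"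

definition WC :: "nat list \<Rightarrow> composition" where
  "WC u = (THE J. J \<in> compositions (length u) \<and> partial_sums J = last_positions u)"

definition K :: "composition \<Rightarrow> composition \<Rightarrow> nat" where
  "K I J = card {u. packed u \<and> length u = weight I \<and> D u = I \<and> WC u = J}"

lemma finite_packed_words: "finite {u. packed u \<and> length u = n}"
proof (rule finite_subset)
  show "{u. packed u \<and> length u = n} \<subseteq> {u. set u \<subseteq> {..n} \<and> length u = n}"
  proof (intro subsetI CollectI conjI)
    fix u x
    assume u: "u \<in> {u. packed u \<and> length u = n}" and x: "x \<in> set u"
    then obtain r where r: "set u = {1..r}" by (auto simp: packed_def)
    then have "r \<le> length u" using card_length[of u] by simp
    with r u x show "x \<in> {..n}" by auto
  qed auto
  show "finite {u. set u \<subseteq> {..n} \<and> length u = n}"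
    by (rule finite_lists_length_eq) simp
qed

end

(*
  By inclusion-exclusion over the compositions coarser than I, it suffices to show that S^J is the
  sum of Psi_(WC u) over the packed words u whose descents are partial sums of J.  This goes by
  induction on the parts of J.  Let L be a composition of length r.

  Algebra: the recursion for Psi telescopes to Psi_n Psi_L = (r + 1) Psi_(n,L) + r Psi_(n|>L), where
  n|>L adds n to the first part of L.  With n S_n = sum_k S_k Psi_(n-k) this yields, by induction
  on n, that S_n Psi_L is the sum over the compositions Q of n of
  binom(n + r, n) Psi_(Q,L) + binom(n + r - 1, n) Psi_(Q|>L), Q|>L adding the last part of Q to the
  first part of L.

  Words: let w be a packed word with WC(w) = L.  Prefixing a nondecreasing word v of length n with
  prescribed positions P of the last occurrences of the letters not in w amounts to choosing v
  nondecreasing on r + |P| letters, with a strict ascent after each p in P other than n.  There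
  are binom(n + r - 1 + [n in P], n) such words, the same coefficients as above.
*)

theory Submission
  imports Defs
begin

section \<open>Multiplying monomial functions by power sums\<close>

text \<open>In the recursion for \<open>n # j # J\<close> the term \<open>s = 1\<close> is the
  product on the left. The remaining terms, reindexed by one, are the negatives of the terms of the
  recursion for \<open>(n + j) # J\<close>.\<close>

lemma psi_mult_Psi_list_Cons:
  "psi n * Psi_list (j # J) = of_nat (length J + 2) * Psi_list (n # j # J)
     + of_nat (length J + 1) * (Psi_list ((n + j) # J) :: 'k::field_char_0 sym)"
proof -
  let ?r = "length J + 1"
  let ?t = "\<lambda>s. (-1) ^ (s - 1) * psi (n + sum_list (take s (j # J))) * (Psi_list (drop s (j # J)) :: 'k sym)"
  have "of_nat (length (n # j # J)) * Psi_list (n # j # J) =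
      (\<Sum>s=1..Suc ?r. (-1) ^ (s - 1) * psi (sum_list (take s (n # j # J)))
         * (Psi_list (drop s (n # j # J)) :: 'k sym))"
    by (subst Psi_list_recursion) auto
  also have "\<dots> = psi n * Psi_list (j # J) + (\<Sum>s=Suc 1..Suc ?r. (-1) ^ (s - 1)
       * psi (sum_list (take s (n # j # J))) * (Psi_list (drop s (n # j # J)) :: 'k sym))"
    by (subst sum.atLeast_Suc_atMost) auto
  also have "(\<Sum>s=Suc 1..Suc ?r. (-1) ^ (s - 1) * psi (sum_list (take s (n # j # J)))
       * (Psi_list (drop s (n # j # J)) :: 'k sym)) = (\<Sum>s=1..?r. - ?t s)"
    unfolding sum.atLeast_Suc_atMost_Suc_shift
  proof (intro sum.cong refl)
    fix s assume "s \<in> {1..?r}"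
    then obtain t where "s = Suc t" by (cases s) auto
    then show "((\<lambda>s. (-1) ^ (s - 1) * psi (sum_list (take s (n # j # J)))
       * (Psi_list (drop s (n # j # J)) :: 'k sym)) \<circ> Suc) s = - ?t s"
      by simp
  qed
  also have "(\<Sum>s=1..?r. - ?t s) = - of_nat ?r * Psi_list ((n + j) # J)"
  proof -
    have "of_nat (length ((n + j) # J)) * Psi_list ((n + j) # J) = (\<Sum>s=1..?r. ?t s)"
      by (subst Psi_list_recursion) (auto intro!: sum.cong simp: take_Cons' drop_Cons' add.assoc)
    then show ?thesis by (simp add: sum_negf del: of_nat_add of_nat_Suc)
  qed
  finally show ?thesis
    by (simp add: algebra_simps)
qed

text \<open>Compositions are indexed by their sets of partial sums, so that prepending parts becomes a
  union with a shifted set and words are compared through their last positions.\<close>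

definition composition_of :: "nat set \<Rightarrow> nat list" where
  "composition_of L = (THE xs. 0 \<notin> set xs \<and> psums xs = L)"

lemma composition_of_psums: "0 \<notin> set xs \<Longrightarrow> composition_of (psums xs) = xs"
  unfolding composition_of_def by (rule the_equality) (simp_all add: psums_inj)

lemma composition_of_cases:
  assumes "finite L" "0 \<notin> L"
  obtains xs where "0 \<notin> set xs" "L = psums xs" "composition_of L = xs"
  using psums_exists[OF assms] composition_of_psums that by blast

lemma finite_psums: "finite (psums xs)"
  by (simp add: psums_eq_image)

lemma card_psums: "0 \<notin> set xs \<Longrightarrow> card (psums xs) = length xs"
proof (induction xs)
  case (Cons x xs)
  then have "x \<notin> (+) x ` psums xs"
    using psums_pos[of xs] by auto
  then show ?case
    using Cons by (simp add: psums_Cons finite_psums card_image)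
qed (simp add: psums_Nil)

definition Psi_set :: "nat set \<Rightarrow> 'k::field_char_0 sym" where
  "Psi_set L = Psi_list (composition_of L)"

lemma Psi_set_psums: "0 \<notin> set xs \<Longrightarrow> Psi_set (psums xs) = (Psi_list xs :: 'k::field_char_0 sym)"
  by (simp add: Psi_set_def composition_of_psums)

lemma Psi_set_empty: "Psi_set {} = (1 :: 'k::field_char_0 sym)"
  using Psi_set_psums[of "[]", where 'k = 'k] by (simp add: psums_Nil Psi_list.simps)

text \<open>A new first part \<open>n\<close> shifts all partial sums by \<open>n\<close> and adds
  \<open>n\<close> itself; enlarging the first part by \<open>n\<close> only shifts them. For empty
  \<open>L\<close> there is no first part to enlarge, and the second coefficient is 0.\<close>

lemma psi_mult_Psi_set:
  assumes "finite L" "0 \<notin> L" "n \<ge> 1"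
  shows "psi n * Psi_set L = of_nat (Suc (card L)) * Psi_set (insert n ((+) n ` L))
     + of_nat (card L) * (Psi_set ((+) n ` L) :: 'k::field_char_0 sym)"
proof -
  obtain xs where xs: "0 \<notin> set xs" "L = psums xs"
    using assms by (auto elim: composition_of_cases)
  show ?thesis
  proof (cases xs)
    case Nil
    have "Psi_set {n} = (psi n :: 'k sym)"
      using Psi_set_psums[of "[n]", where 'k = 'k] assms
      by (simp add: psums_Cons psums_Nil Psi_list_single)
    then show ?thesis using xs Nil by (simp add: psums_Nil Psi_set_empty)
  next
    case (Cons j J)
    have "Psi_set (insert n ((+) n ` L)) = (Psi_list (n # j # J) :: 'k sym)"
      using Psi_set_psums[of "n # j # J", where 'k = 'k] assms xs Cons by (simp add: psums_Cons)
    moreover have "(+) n ` L = psums ((n + j) # J)"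
      using xs Cons by (simp add: psums_Cons image_image add.assoc)
    then have "Psi_set ((+) n ` L) = (Psi_list ((n + j) # J) :: 'k sym)"
      using Psi_set_psums[of "(n + j) # J", where 'k = 'k] xs Cons by simp
    moreover have "Psi_set L = (Psi_list (j # J) :: 'k sym)" "card L = length J + 1"
      using xs Cons by (simp_all add: card_psums Psi_set_psums)
    ultimately show ?thesis
      using psi_mult_Psi_list_Cons[of n j J, where 'k = 'k] by simp
  qed
qed

section \<open>Binomial sums and the product of a complete function with a monomial function\<close>

lemma mult_of_nat_left_commute: "x * (of_nat n * y) = of_nat n * (x * (y :: 'a::semiring_1))"
  by (metis mult.assoc mult_of_nat_commute)

text \<open>The algebra has no division, so the integer is cancelled through the scalar
  \<open>1 / of_nat n\<close> of the field.\<close>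

lemma sym_of_nat_cancel:
  assumes "of_nat n * x = of_nat n * (y :: 'k::field_char_0 sym)" "n \<noteq> 0"
  shows "x = y"
proof -
  have "of_nat n * scale (1 / of_nat n) z = scale (1 / of_nat n) (of_nat n * z)" for z :: "'k sym"
    by (simp add: scale_def mult_of_nat_commute mult.assoc)
  then show ?thesis
    using assms scale_inverse_of_nat by metis
qed

text \<open>A hockey-stick identity: the raised term at \<open>k = M\<close> equals the sum of
  \<open>(k + r) choose k\<close> over all \<open>k \<le> M\<close>, and Pascal's rule absorbs the
  later terms one by one.\<close>

lemma sum_binomial_shifted:
  assumes "M < n"
  shows "(\<Sum>k=M..<n. (k + r + of_bool (k = M)) choose k) = (n + r) choose (n - 1)"
proof -
  have "(\<Sum>k=M..<Suc (M + d). (k + r + of_bool (k = M)) choose k) = (Suc (M + d) + r) choose (M + d)" for d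
  proof (induction d)
    case (Suc d)
    then show ?case by (simp add: add.commute)
  qed simp
  from this[of "n - Suc M"] assms show ?thesis by simp
qed

text \<open>The admissible \<open>k\<close> run from the maximum of \<open>P\<close> to
  \<open>n - 1\<close>, and only the maximum itself can lie in \<open>P\<close>; this is the
  hockey-stick sum. Absorption then trades the factor \<open>Suc r\<close> for
  \<open>n\<close>.\<close>

lemma sum_binomial_above_subset:
  assumes "P \<subseteq> {1..<n}" "n \<ge> 1"
  shows "Suc r * (\<Sum>k | k < n \<and> P \<subseteq> {1..k}. (k + r + of_bool (k \<in> P)) choose k) = n * ((n + r) choose n)"
proof -
  define M where "M = Max (insert 0 P)"
  have fin: "finite P" using assms finite_subset by blast
  have M: "M \<in> insert 0 P" "\<And>p. p \<in> P \<Longrightarrow> p \<le> M"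
    using fin Max_in[of "insert 0 P"] unfolding M_def by (auto intro: Max_ge)
  have "M < n" using M assms by auto
  have set: "{k. k < n \<and> P \<subseteq> {1..k}} = {M..<n}"
  proof (intro set_eqI iffI)
    fix k assume "k \<in> {k. k < n \<and> P \<subseteq> {1..k}}"
    then show "k \<in> {M..<n}" using M(1) by auto
  next
    fix k assume "k \<in> {M..<n}"
    then show "k \<in> {k. k < n \<and> P \<subseteq> {1..k}}" using M(2) assms(1) by force
  qed
  \<comment> \<open>For empty \<open>P\<close>, \<open>M\<close> is 0 and the upper entries differ
    at \<open>k = 0\<close>, but any number choose 0 is 1.\<close>
  have "((k + r + of_bool (k \<in> P)) choose k) = ((k + r + of_bool (k = M)) choose k)" if "k \<in> {M..<n}" for k
    using M that by (cases "k = 0") (auto simp: of_bool_def dest: M(2))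
  then have "(\<Sum>k | k < n \<and> P \<subseteq> {1..k}. (k + r + of_bool (k \<in> P)) choose k) = (n + r) choose (n - 1)"
    unfolding set using sum_binomial_shifted[OF \<open>M < n\<close>] by simp
  moreover obtain m where m: "n = Suc m" using assms by (cases n) auto
  have "Suc r * ((n + r) choose (n - 1)) = n * ((n + r) choose n)"
  proof -
    have "((n + r) choose n) * n = ((n + r) choose m) * (n + r - m)"
      using binomial_absorb_comp[of "n + r" m] binomial_absorption[of m "n + r"] m
      by (simp add: mult.commute)
    then show ?thesis using m by (simp add: mult.commute)
  qed
  ultimately show ?thesis by simp
qed

text \<open>\<open>P\<close> holds the partial sums contributed by the composition of
  \<open>n\<close> put in front of \<open>L\<close>; for \<open>n > 0\<close>,
  \<open>n \<in> P\<close> tells whether it is juxtaposed to \<open>L\<close> or glued to its first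
  part. Gluing to an empty \<open>L\<close> is ruled out by
  \<open>(n - 1) choose n = 0\<close>.\<close>

lemma S_mult_Psi_set:
  assumes "finite L" "0 \<notin> L"
  shows "S n * Psi_set L = (\<Sum>P\<in>Pow {1..n}.
    of_nat ((n + card L - 1 + of_bool (n \<in> P)) choose n) * Psi_set (P \<union> (+) n ` L) :: 'k::field_char_0 sym)"
  using assms
proof (induction n arbitrary: L rule: less_induct)
  case (less n)
  show ?case
  proof (cases "n = 0")
    case True
    then show ?thesis by (simp add: S_def)
  next
    case False
    let ?r = "card L"
    \<comment> \<open>For \<open>P\<close> inside \<open>{1..<n}\<close>, \<open>?X P\<close> is the
      juxtaposed term, with \<open>n\<close> a partial sum, and \<open>?Y P\<close> the glued
      one.\<close>
    let ?X = "\<lambda>P. Psi_set (P \<union> insert n ((+) n ` L)) :: 'k sym"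
    let ?Y = "\<lambda>P. Psi_set (P \<union> (+) n ` L) :: 'k sym"
    let ?a = "\<lambda>k P. Suc ?r * ((k + ?r + of_bool (k \<in> P)) choose k)"
    let ?b = "\<lambda>k P. ?r * ((k + ?r - 1 + of_bool (k \<in> P)) choose k)"
    have step: "S k * psi (n - k) * Psi_set L =
      (\<Sum>P\<in>Pow {1..k}. of_nat (?a k P) * ?X P + of_nat (?b k P) * ?Y P)" if k: "k < n" for k
    proof -
      obtain d where d: "n = k + d" "d > 0"
        using k less_imp_add_positive by blast
      \<comment> \<open>Multiplication by \<open>psi d\<close> yields these two sets, and the
        induction hypothesis at \<open>k\<close> applies to both. \<open>?L1\<close> has one element
        more than \<open>L\<close>, hence no \<open>- 1\<close> in \<open>?a\<close>.\<close>
      let ?L1 = "insert d ((+) d ` L)" and ?L2 = "(+) d ` L"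
      have L1: "finite ?L1" "0 \<notin> ?L1" "card ?L1 = Suc ?r"
        using less.prems d by (auto simp: card_image card_insert_if)
      have L2: "finite ?L2" "0 \<notin> ?L2" "card ?L2 = ?r"
        using less.prems d by (auto simp: card_image)
      have im: "(+) k ` ?L2 = (+) n ` L" "(+) k ` ?L1 = insert n ((+) n ` L)"
        using d by (auto simp: image_image add.assoc)
      have "S k * psi (n - k) * Psi_set L = of_nat (Suc ?r) * (S k * Psi_set ?L1)
          + of_nat ?r * (S k * (Psi_set ?L2 :: 'k sym))"
        using psi_mult_Psi_set[of L d, where 'k = 'k] less.prems d
        by (simp add: mult.assoc distrib_left mult_of_nat_left_commute del: of_nat_Suc)
      also have "S k * (Psi_set ?L1 :: 'k sym) =
          (\<Sum>P\<in>Pow {1..k}. of_nat ((k + ?r + of_bool (k \<in> P)) choose k) * ?X P)"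
        using less.IH[OF k L1(1,2)] unfolding L1(3) im by simp
      also have "S k * (Psi_set ?L2 :: 'k sym) =
          (\<Sum>P\<in>Pow {1..k}. of_nat ((k + ?r - 1 + of_bool (k \<in> P)) choose k) * ?Y P)"
        using less.IH[OF k L2(1,2)] unfolding L2(3) im by simp
      finally show ?thesis
        by (simp only: sum_distrib_left sum.distrib of_nat_mult mult.assoc)
    qed
    have coef: "(\<Sum>k | k < n \<and> P \<subseteq> {1..k}. of_nat (?a k P) * ?X P + of_nat (?b k P) * ?Y P)
        = of_nat n * (of_nat ((n + ?r) choose n) * ?X P + of_nat ((n + ?r - 1) choose n) * ?Y P)"
      if P: "P \<in> Pow {1..<n}" for P
    proof -
      let ?K = "{k. k < n \<and> P \<subseteq> {1..k}}"
      have "(\<Sum>k\<in>?K. ?a k P) = n * ((n + ?r) choose n)"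
        unfolding sum_distrib_left[symmetric] using P False
        by (intro sum_binomial_above_subset) auto
      moreover have "(\<Sum>k\<in>?K. ?b k P) = n * ((n + ?r - 1) choose n)"
      proof (cases ?r)
        \<comment> \<open>Both sides vanish: the left one by its factor \<open>?r\<close>, the right
          one because \<open>(n - 1) choose n = 0\<close>.\<close>
        case 0
        then show ?thesis using False by simp
      next
        case (Suc r)
        then show ?thesis
          unfolding sum_distrib_left[symmetric]
          using P False sum_binomial_above_subset[of P n r] by simp
      qed
      moreover have "(\<Sum>k\<in>?K. of_nat (?a k P) * ?X P + of_nat (?b k P) * ?Y P)
          = of_nat (\<Sum>k\<in>?K. ?a k P) * ?X P + of_nat (\<Sum>k\<in>?K. ?b k P) * ?Y P"
        by (simp only: sum.distrib of_nat_sum sum_distrib_right)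
      ultimately show ?thesis
        by (simp add: distrib_left mult.assoc)
    qed
    have "of_nat n * (S n * Psi_set L) = (\<Sum>k<n. S k * psi (n - k) * (Psi_set L :: 'k sym))"
      using psi_recursion[of n, where 'k = 'k] False
      by (simp add: mult.assoc[symmetric] sum_distrib_right atLeast0LessThan)
    \<comment> \<open>Each \<open>Pow {1..k}\<close> is a restriction of the fixed set
      \<open>Pow {1..<n}\<close>, so that the sums over \<open>k\<close> and \<open>P\<close> can be
      exchanged.\<close>
    also have "\<dots> = (\<Sum>k<n. \<Sum>P | P \<in> Pow {1..<n} \<and> P \<subseteq> {1..k}.
        of_nat (?a k P) * ?X P + of_nat (?b k P) * ?Y P)"
    proof (intro sum.cong refl)
      fix k assume k: "k \<in> {..<n}"
      then have "{P. P \<in> Pow {1..<n} \<and> P \<subseteq> {1..k}} = Pow {1..k}"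
        by force
      then show "S k * psi (n - k) * (Psi_set L :: 'k sym) = (\<Sum>P | P \<in> Pow {1..<n} \<and> P \<subseteq> {1..k}.
        of_nat (?a k P) * ?X P + of_nat (?b k P) * ?Y P)"
        using step k by simp
    qed
    also have "\<dots> = (\<Sum>P\<in>Pow {1..<n}. \<Sum>k | k \<in> {..<n} \<and> P \<subseteq> {1..k}.
        of_nat (?a k P) * ?X P + of_nat (?b k P) * ?Y P)"
      by (rule sum.swap_restrict) auto
    also have "\<dots> = (\<Sum>P\<in>Pow {1..<n}.
        of_nat n * (of_nat ((n + ?r) choose n) * ?X P + of_nat ((n + ?r - 1) choose n) * ?Y P))"
      using coef by (intro sum.cong) auto
    also have "\<dots> = of_nat n * (\<Sum>P\<in>Pow {1..<n}.
        of_nat ((n + ?r) choose n) * ?X P + of_nat ((n + ?r - 1) choose n) * ?Y P)"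
      by (simp add: sum_distrib_left)
    finally have "S n * Psi_set L = (\<Sum>P\<in>Pow {1..<n}.
        of_nat ((n + ?r) choose n) * ?X P + of_nat ((n + ?r - 1) choose n) * ?Y P)"
      using False by (rule sym_of_nat_cancel)
    also have "\<dots> = (\<Sum>P\<in>Pow {1..n}.
        of_nat ((n + ?r - 1 + of_bool (n \<in> P)) choose n) * ?Y P)"
    proof -
      \<comment> \<open>The subsets of \<open>{1..n}\<close> avoiding \<open>n\<close> give the
        \<open>?Y\<close> terms, those containing it the \<open>?X\<close> terms.\<close>
      have ivl: "{1..n} = insert n {1..<n}" using False by auto
      have "(\<Sum>P\<in>Pow {1..n}. of_nat ((n + ?r - 1 + of_bool (n \<in> P)) choose n) * ?Y P)
          = (\<Sum>P\<in>Pow {1..<n}. of_nat ((n + ?r - 1 + of_bool (n \<in> P)) choose n) * ?Y P)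
          + (\<Sum>P\<in>insert n ` Pow {1..<n}. of_nat ((n + ?r - 1 + of_bool (n \<in> P)) choose n) * ?Y P)"
        unfolding ivl Pow_insert by (rule sum.union_disjoint) auto
      also have "(\<Sum>P\<in>insert n ` Pow {1..<n}. of_nat ((n + ?r - 1 + of_bool (n \<in> P)) choose n) * ?Y P)
          = (\<Sum>P\<in>Pow {1..<n}. of_nat ((n + ?r) choose n) * ?X P)"
      proof -
        have "inj_on (insert n) (Pow {1..<n})"
          by (intro inj_onI) (metis Pow_iff atLeastLessThan_iff insert_ident less_irrefl subsetD)
        then show ?thesis
          using False by (subst sum.reindex) (auto intro!: sum.cong)
      qed
      also have "(\<Sum>P\<in>Pow {1..<n}. of_nat ((n + ?r - 1 + of_bool (n \<in> P)) choose n) * ?Y P)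
          = (\<Sum>P\<in>Pow {1..<n}. of_nat ((n + ?r - 1) choose n) * ?Y P)"
        by (intro sum.cong) auto
      finally show ?thesis by (simp add: sum.distrib add.commute)
    qed
    finally show ?thesis .
  qed
qed

section \<open>Last positions and descents of concatenated words\<close>

lemma last_positions_eq: "last_positions u = {i \<in> {1..length u}. u ! (i - 1) \<notin> set (drop i u)}"
proof -
  have "(\<forall>j. i < j \<and> j \<le> length u \<longrightarrow> u ! (j - 1) \<noteq> u ! (i - 1)) \<longleftrightarrow> u ! (i - 1) \<notin> set (drop i u)"
    if "i \<le> length u" for i
  proof
    assume *: "\<forall>j. i < j \<and> j \<le> length u \<longrightarrow> u ! (j - 1) \<noteq> u ! (i - 1)"
    show "u ! (i - 1) \<notin> set (drop i u)"
    proof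
      assume "u ! (i - 1) \<in> set (drop i u)"
      then obtain l where "l < length u - i" "u ! (i + l) = u ! (i - 1)"
        using that by (auto simp: in_set_conv_nth)
      moreover from this have "Suc (i + l) \<le> length u" by simp
      ultimately show False using *[rule_format, of "Suc (i + l)"] by simp
    qed
  next
    assume *: "u ! (i - 1) \<notin> set (drop i u)"
    show "\<forall>j. i < j \<and> j \<le> length u \<longrightarrow> u ! (j - 1) \<noteq> u ! (i - 1)"
    proof (intro allI impI)
      fix j assume j: "i < j \<and> j \<le> length u"
      then have "drop i u ! (j - 1 - i) = u ! (j - 1)"
        using that by simp
      moreover have "drop i u ! (j - 1 - i) \<in> set (drop i u)"
        using j by (intro nth_mem) auto
      ultimately show "u ! (j - 1) \<noteq> u ! (i - 1)" using * by auto
    qed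
  qed
  then show ?thesis unfolding last_positions_def by auto
qed

lemma last_positions_subset: "last_positions u \<subseteq> {1..length u}"
  by (auto simp: last_positions_def)

text \<open>A last occurrence in \<open>v\<close> survives iff its letter is absent from
  \<open>w\<close>; those in \<open>w\<close> do not depend on \<open>v\<close>.\<close>

lemma last_positions_append:
  "last_positions (v @ w) =
     {p \<in> last_positions v. v ! (p - 1) \<notin> set w} \<union> (+) (length v) ` last_positions w"
proof (intro set_eqI iffI)
  fix p assume p: "p \<in> last_positions (v @ w)"
  show "p \<in> {p \<in> last_positions v. v ! (p - 1) \<notin> set w} \<union> (+) (length v) ` last_positions w"
  proof (cases "p \<le> length v")
    case True
    then show ?thesis using p by (auto simp: last_positions_eq nth_append split: if_splits)
  next
    case False
    then obtain q where "p = length v + Suc q"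
      by (auto simp: not_le less_iff_Suc_add)
    then show ?thesis using p by (auto simp: last_positions_eq nth_append intro!: image_eqI[of _ _ "Suc q"])
  qed
next
  fix p assume "p \<in> {p \<in> last_positions v. v ! (p - 1) \<notin> set w} \<union> (+) (length v) ` last_positions w"
  then show "p \<in> last_positions (v @ w)"
    by (auto simp: last_positions_eq nth_append)
qed

lemma last_positions_single: "last_positions [x] = {1}"
  by (auto simp: last_positions_eq)

lemma last_positions_Nil: "last_positions [] = {}"
  by (auto simp: last_positions_eq)

lemma card_last_positions: "card (last_positions u) = card (set u)"
proof (induction u)
  case (Cons x u)
  have "last_positions (x # u) = (if x \<in> set u then {} else {1}) \<union> Suc ` last_positions u"
    using last_positions_append[of "[x]" u] by (auto simp: last_positions_single)
  moreover have "1 \<notin> Suc ` last_positions u" "finite (last_positions u)"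
    using last_positions_subset[of u] finite_subset by auto
  ultimately show ?case
    using Cons by (simp add: card_image insert_absorb)
qed (simp add: last_positions_Nil)

lemma inj_on_last_positions: "inj_on (\<lambda>p. u ! (p - 1)) (last_positions u)"
  unfolding inj_on_def last_positions_def by (auto, metis linorder_neqE_nat)

lemma last_positions_image: "(\<lambda>p. u ! (p - 1)) ` last_positions u = set u"
proof (rule card_subset_eq)
  show "(\<lambda>p. u ! (p - 1)) ` last_positions u \<subseteq> set u"
    using last_positions_subset[of u] by force
  show "card ((\<lambda>p. u ! (p - 1)) ` last_positions u) = card (set u)"
    using card_image[OF inj_on_last_positions] card_last_positions by metis
qed simp

lemma descents_append_subset_iff:
  "descents (v @ w) \<subseteq> insert (length v) ((+) (length v) ` X) \<longleftrightarrow> sorted v \<and> descents w \<subseteq> X"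
proof (intro iffI conjI)
  assume *: "descents (v @ w) \<subseteq> insert (length v) ((+) (length v) ` X)"
  show "sorted v"
  proof (rule ccontr)
    assume "\<not> sorted v"
    then obtain i where i: "Suc i < length v" "v ! i > v ! Suc i"
      by (auto simp: sorted_iff_nth_Suc not_le)
    then have "Suc i \<in> descents (v @ w)"
      by (auto simp: descents_def nth_append)
    then show False using * i by auto
  qed
  show "descents w \<subseteq> X"
  proof
    fix i assume i: "i \<in> descents w"
    then obtain q where "i = Suc q" by (cases i) (auto simp: descents_def)
    then have "length v + i \<in> descents (v @ w)"
      using i by (auto simp: descents_def nth_append)
    with * have "length v + i \<in> insert (length v) ((+) (length v) ` X)" by blast
    then show "i \<in> X" using \<open>i = Suc q\<close> by auto
  qed
next
  assume *: "sorted v \<and> descents w \<subseteq> X"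
  show "descents (v @ w) \<subseteq> insert (length v) ((+) (length v) ` X)"
  proof
    fix i assume i: "i \<in> descents (v @ w)"
    show "i \<in> insert (length v) ((+) (length v) ` X)"
    proof (cases i "length v" rule: linorder_cases)
      case less
      then have "v ! (i - 1) \<le> v ! i"
        using * by (intro sorted_nth_mono) auto
      then show ?thesis using i less less_imp_diff_less[OF less, of 1]
        by (auto simp: descents_def nth_append)
    next
      case greater
      then obtain q where q: "i = length v + Suc q" by (auto simp: less_iff_Suc_add)
      then have "Suc q \<in> descents w" using i by (auto simp: descents_def nth_append)
      then show ?thesis using * q by blast
    qed simp
  qed
qed

section \<open>Counting nondecreasing prefixes\<close>

text \<open>\<open>rows A P k\<close> are the possible prefixes of length \<open>k\<close> of a word on \<open>A\<close>, when exactly the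
  letters at the positions in \<open>P\<close> do not recur after the prefix.\<close>

definition rows :: "nat set \<Rightarrow> nat set \<Rightarrow> nat \<Rightarrow> nat list set" where
  "rows A P k = {v. length v = k \<and> sorted v \<and> set v \<subseteq> A \<and> P \<subseteq> last_positions v}"

lemma finite_rows: "finite A \<Longrightarrow> finite (rows A P k)"
  by (rule finite_subset[OF _ finite_lists_length_eq[of A k]]) (auto simp: rows_def)

text \<open>A sorted word can use the maximum \<open>b\<close> only if it ends with it. If
  \<open>k \<in> P\<close>, the letter before this final \<open>b\<close> must differ from
  \<open>b\<close>, so all earlier letters lie in \<open>A\<close>. If not, no earlier
  \<open>p \<in> P\<close> carries \<open>b\<close> anyway, since by sortedness \<open>b\<close>
  would recur at \<open>k\<close>. The final position is always a last one.\<close>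

lemma rows_insert_max:
  assumes b: "\<forall>a\<in>A. a < b" and P: "P \<subseteq> {1..Suc k}"
  shows "rows (insert b A) P (Suc k) =
    rows A P (Suc k) \<union> (\<lambda>v. v @ [b]) ` rows (if k \<in> P then A else insert b A) (P \<inter> {1..k}) k"
proof (intro set_eqI iffI)
  fix u assume u: "u \<in> rows (insert b A) P (Suc k)"
  then obtain v x where uv: "u = v @ [x]" "length v = k"
    by (metis (mono_tags, lifting) length_Suc_conv_rev mem_Collect_eq rows_def)
  have srt: "sorted v" "\<forall>y\<in>set v. y \<le> x" and sub: "set v \<subseteq> insert b A" "x \<in> insert b A"
    and lp: "P \<subseteq> {p \<in> last_positions v. v ! (p - 1) \<noteq> x} \<union> {Suc k}"
    using u uv by (auto simp: rows_def sorted_append last_positions_append last_positions_single)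
  show "u \<in> rows A P (Suc k) \<union>
      (\<lambda>v. v @ [b]) ` rows (if k \<in> P then A else insert b A) (P \<inter> {1..k}) k"
  proof (cases "x = b")
    case True
    have "v \<in> rows (if k \<in> P then A else insert b A) (P \<inter> {1..k}) k"
    proof -
      have "P \<inter> {1..k} \<subseteq> last_positions v" using lp by auto
      moreover have "set v \<subseteq> A" if "k \<in> P"
      proof
        fix y assume y: "y \<in> set v"
        have k: "v ! (k - 1) \<noteq> b" "k \<ge> 1" using lp that True P by auto
        obtain l where "l < k" "y = v ! l" using y uv by (auto simp: in_set_conv_nth)
        then have "y \<le> v ! (k - 1)" using srt uv by (auto intro: sorted_nth_mono)
        moreover have "v ! (k - 1) \<in> set v" using k uv by simp
        then have "v ! (k - 1) < b" using k sub b by auto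
        ultimately show "y \<in> A" using sub y by auto
      qed
      ultimately show ?thesis using srt sub uv by (auto simp: rows_def)
    qed
    then show ?thesis using True uv by auto
  next
    case False
    then have "x < b" using sub b by auto
    then have "set u \<subseteq> A" using srt sub uv by force
    then show ?thesis using u by (auto simp: rows_def)
  qed
next
  fix u assume "u \<in> rows A P (Suc k) \<union>
      (\<lambda>v. v @ [b]) ` rows (if k \<in> P then A else insert b A) (P \<inter> {1..k}) k"
  then consider "u \<in> rows A P (Suc k)"
    | v where "u = v @ [b]" "v \<in> rows (if k \<in> P then A else insert b A) (P \<inter> {1..k}) k"
    by auto
  then show "u \<in> rows (insert b A) P (Suc k)"
  proof cases
    case 1
    then show ?thesis by (auto simp: rows_def)
  next
    case 2
    have v: "length v = k" "sorted v" "set v \<subseteq> insert b A" "k \<in> P \<Longrightarrow> set v \<subseteq> A"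
      "P \<inter> {1..k} \<subseteq> last_positions v"
      using 2(2) by (auto simp: rows_def split: if_splits)
    have ne: "v ! (p - 1) \<noteq> b" if p: "p \<in> P" "1 \<le> p" "p \<le> k" for p
    proof (cases "k \<in> P")
      case True
      have "v ! (p - 1) \<in> set v" using p v by (intro nth_mem) auto
      then show ?thesis using v(4) True b by auto
    next
      case False
      then have "p < k" using p by (cases "p = k") auto
      show ?thesis
      proof
        assume eq: "v ! (p - 1) = b"
        have "v ! (p - 1) \<le> v ! (k - 1)" using v \<open>p < k\<close> by (intro sorted_nth_mono) auto
        moreover have "v ! (k - 1) \<in> set v" using v \<open>p < k\<close> by (intro nth_mem) auto
        ultimately have "v ! (k - 1) = b" using v(3) b eq by fastforce
        moreover have "p \<in> last_positions v" using v p by auto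
        ultimately show False using \<open>p < k\<close> v(1) eq unfolding last_positions_def by auto
      qed
    qed
    have "P \<subseteq> last_positions u"
    proof
      fix p assume "p \<in> P"
      then have "p = Suc k \<or> p \<in> last_positions v \<and> v ! (p - 1) \<noteq> b"
        using v(5) P ne[of p] by (cases "p = Suc k") force+
      then show "p \<in> last_positions u"
        using v(1) 2(1) by (auto simp: last_positions_append last_positions_single)
    qed
    moreover have "sorted u" using v(2,3) b 2(1) by (auto simp: sorted_append less_imp_le)
    ultimately show ?thesis using v 2(1) by (auto simp: rows_def)
  qed
qed

text \<open>Membership of \<open>p < k\<close> in \<open>P\<close> forces a strict ascent after
  \<open>p\<close>, and each such ascent lowers by one the upper entry of the count of all
  nondecreasing words. Adding the letters of \<open>A\<close> in increasing order turns the
  splitting into Pascal's rule.\<close>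

lemma card_rows:
  assumes "finite A" "P \<subseteq> {1..k}"
  shows "card (rows A P k) = (card A + k - 1 - card (P \<inter> {1..<k})) choose k"
  using assms
proof (induction k arbitrary: A P)
  case 0
  then have "rows A P 0 = {[]}" by (auto simp: rows_def last_positions_Nil)
  then show ?case by simp
next
  case (Suc k)
  let ?d = "card (P \<inter> {1..<Suc k})"
  have P': "P \<inter> {1..<Suc k} = (if k \<in> P \<and> k \<ge> 1 then insert k (P \<inter> {1..<k}) else P \<inter> {1..<k})"
    by (auto simp: less_Suc_eq)
  have d: "?d = card (P \<inter> {1..<k}) + of_bool (k \<in> P)"
    unfolding P' using Suc.prems(2) by auto
  have dk: "?d \<le> k" using card_mono[of "{1..<Suc k}" "P \<inter> {1..<Suc k}"] by simp
  have inter: "P \<inter> {1..k} \<inter> {1..<k} = P \<inter> {1..<k}" by auto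
  from \<open>finite A\<close> show ?case
  proof (induction A rule: finite_linorder_max_induct)
    case empty
    have "rows {} P (Suc k) = {}" by (auto simp: rows_def)
    then show ?case by (simp add: binomial_eq_0)
  next
    case (insert b A)
    let ?B = "if k \<in> P then A else insert b A"
    have "b \<notin> A" using insert by auto
    have "card (rows (insert b A) P (Suc k)) =
      card (rows A P (Suc k)) + card ((\<lambda>v. v @ [b]) ` rows ?B (P \<inter> {1..k}) k)"
      using insert \<open>b \<notin> A\<close> unfolding rows_insert_max[OF insert(2) Suc.prems(2)]
      by (intro card_Un_disjoint finite_imageI finite_rows) (auto simp: rows_def)
    also have "card ((\<lambda>v. v @ [b]) ` rows ?B (P \<inter> {1..k}) k) = card (rows ?B (P \<inter> {1..k}) k)"
      by (intro card_image) (auto simp: inj_on_def)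
    also have "\<dots> = (card ?B + k - 1 - card (P \<inter> {1..k} \<inter> {1..<k})) choose k"
      using insert(1) by (intro Suc.IH) auto
    also note inter
    \<comment> \<open>If \<open>k \<in> P\<close>, the letter missing from \<open>?B\<close> is
      compensated by \<open>k\<close> being counted in \<open>?d\<close>.\<close>
    also have "card ?B + k - 1 - card (P \<inter> {1..<k}) = card A + k - ?d"
      using insert(1) \<open>b \<notin> A\<close> d by auto
    also have "card (rows A P (Suc k)) = (card A + k - ?d) choose Suc k"
      using insert by simp
    finally show ?case
      using insert(1) \<open>b \<notin> A\<close> dk by (simp add: Suc_diff_le)
  qed
qed

section \<open>Counting words with prescribed last positions\<close>

text \<open>The alphabet is arbitrary because cutting off a prefix can remove letters anywhere in
  it.\<close>

definition words :: "nat set \<Rightarrow> nat set \<Rightarrow> nat list \<Rightarrow> nat list set" where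
  "words A L I = {u. length u = sum_list I \<and> set u = A \<and> last_positions u = L \<and> descents u \<subseteq> psums I}"

text \<open>An infinite \<open>A\<close> is harmless: it is not the set of letters of any
  list.\<close>

lemma finite_words: "finite (words A L I)"
proof (cases "words A L I = {}")
  case False
  then have "finite A" by (auto simp: words_def)
  then have "finite {u. set u \<subseteq> A \<and> length u = sum_list I}"
    by (rule finite_lists_length_eq)
  then show ?thesis
    by (rule rev_finite_subset) (auto simp: words_def)
qed auto

lemma words_Nil: "words {} {} [] = {[]}"
  by (auto simp: words_def last_positions_Nil descents_def)

text \<open>Cut the word after \<open>k\<close> letters. The letters at the positions in
  \<open>P\<close> are exactly those of the prefix that do not recur, so they must be missing from
  the rest, which uses all others.\<close>

lemma words_Cons:
  assumes P: "P \<subseteq> {1..k}" and "0 \<notin> L"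
  shows "words A (P \<union> (+) k ` L) (k # I) =
    (\<lambda>(v, w). v @ w) ` (SIGMA v:rows A P k. words (A - (\<lambda>p. v ! (p - 1)) ` P) L I)"
proof (intro set_eqI iffI)
  fix u assume u: "u \<in> words A (P \<union> (+) k ` L) (k # I)"
  define v w where "v = take k u" and "w = drop k u"
  have uv: "u = v @ w" "length v = k" "length w = sum_list I"
    using u by (auto simp: v_def w_def words_def)
  have lp: "{p \<in> last_positions v. v ! (p - 1) \<notin> set w} \<union> (+) k ` last_positions w = P \<union> (+) k ` L"
    using u uv by (auto simp: words_def last_positions_append)
  have disj: "{p \<in> last_positions v. v ! (p - 1) \<notin> set w} \<subseteq> {1..k}" "P \<subseteq> {1..k}"
    "(+) k ` last_positions w \<inter> {1..k} = {}" "(+) k ` L \<inter> {1..k} = {}"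
    using uv(2) P \<open>0 \<notin> L\<close> last_positions_subset[of v] last_positions_subset[of w]
    by auto
  have 1: "{p \<in> last_positions v. v ! (p - 1) \<notin> set w} = P" using lp disj by blast
  have "(+) k ` last_positions w = (+) k ` L" using lp disj by blast
  then have 2: "last_positions w = L" by (simp add: inj_image_eq_iff)
  have srt: "sorted v" "descents w \<subseteq> psums I"
    using u uv descents_append_subset_iff[of v w] by (auto simp: words_def psums_Cons)
  have A: "set v \<union> set w = A" using u uv by (auto simp: words_def)
  \<comment> \<open>A letter of \<open>v\<close> absent from \<open>w\<close> has its last
    occurrence in \<open>u\<close> at its last position in \<open>v\<close>.\<close>
  have "(\<lambda>p. v ! (p - 1)) ` P = set v - set w"
  proof (intro set_eqI iffI)
    fix x assume "x \<in> (\<lambda>p. v ! (p - 1)) ` P"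
    then obtain p where p: "x = v ! (p - 1)" "p \<in> P" by auto
    then have "p - 1 < length v" using P uv by force
    then have "x \<in> set v" using p by simp
    moreover have "x \<notin> set w" using p 1 by blast
    ultimately show "x \<in> set v - set w" by simp
  next
    fix x assume x: "x \<in> set v - set w"
    then have "x \<in> (\<lambda>p. v ! (p - 1)) ` last_positions v"
      unfolding last_positions_image by simp
    then show "x \<in> (\<lambda>p. v ! (p - 1)) ` P" using 1 x by blast
  qed
  then have "set w = A - (\<lambda>p. v ! (p - 1)) ` P" using A by auto
  then show "u \<in> (\<lambda>(v, w). v @ w) ` (SIGMA v:rows A P k. words (A - (\<lambda>p. v ! (p - 1)) ` P) L I)"
    using uv 1 2 srt A by (intro image_eqI[of _ _ "(v, w)"]) (auto simp: rows_def words_def)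
next
  fix u assume "u \<in> (\<lambda>(v, w). v @ w) ` (SIGMA v:rows A P k. words (A - (\<lambda>p. v ! (p - 1)) ` P) L I)"
  then obtain v w where uv: "u = v @ w" and v: "v \<in> rows A P k"
    and w: "w \<in> words (A - (\<lambda>p. v ! (p - 1)) ` P) L I" by auto
  have k: "length v = k" and sub: "P \<subseteq> last_positions v" "set v \<subseteq> A" using v by (auto simp: rows_def)
  have "(\<lambda>p. v ! (p - 1)) ` P \<subseteq> set v" using P k by force
  then have A: "set u = A" using uv w sub by (auto simp: words_def)
  have "{p \<in> last_positions v. v ! (p - 1) \<notin> set w} = P"
  proof -
    have "v ! (p - 1) \<in> set w \<longleftrightarrow> p \<notin> P" if p: "p \<in> last_positions v" for p
    proof -
      have "v ! (p - 1) \<in> set v" using last_positions_image[of v] p by blast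
      then have "v ! (p - 1) \<in> set w \<longleftrightarrow> v ! (p - 1) \<notin> (\<lambda>p. v ! (p - 1)) ` P"
        using w sub by (auto simp: words_def)
      also have "\<dots> \<longleftrightarrow> p \<notin> P"
        using inj_on_image_mem_iff[OF inj_on_last_positions p sub(1)] by simp
      finally show ?thesis .
    qed
    then show ?thesis using sub by auto
  qed
  moreover have "sorted v" "descents w \<subseteq> psums I" "last_positions w = L" "length w = sum_list I"
    using v w by (auto simp: rows_def words_def)
  ultimately show "u \<in> words A (P \<union> (+) k ` L) (k # I)"
    using uv k A descents_append_subset_iff[of v w "psums I"]
    by (auto simp: words_def last_positions_append psums_Cons)
qed

lemma shifted_union_decomposition:
  assumes "finite L" "0 \<notin> (L :: nat set)"
  obtains P L' where "P \<subseteq> {1..k}" "finite L'" "0 \<notin> L'" "L = P \<union> (+) k ` L'"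
    "card L = card P + card L'"
proof
  let ?P = "L \<inter> {1..k}" and ?L' = "{j. j \<noteq> 0 \<and> k + j \<in> L}"
  show L: "L = ?P \<union> (+) k ` ?L'"
  proof (intro set_eqI iffI)
    fix x assume "x \<in> L"
    then show "x \<in> ?P \<union> (+) k ` ?L'"
      using assms by (cases "x \<le> k") (auto intro!: image_eqI[of x _ "x - k"] simp: Suc_le_eq intro: gr0I)
  qed auto
  have "finite ((+) k ` ?L')" using assms(1) L by (metis finite_Un)
  then show "finite ?L'" by (simp add: finite_image_iff)
  have "card L = card (?P \<union> (+) k ` ?L')" using L by simp
  also have "\<dots> = card ?P + card ((+) k ` ?L')"
    using \<open>finite ((+) k ` ?L')\<close> by (intro card_Un_disjoint) auto
  finally show "card L = card ?P + card ?L'" by (simp add: card_image)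
qed auto

text \<open>The alphabet left for the rest depends on the prefix, but its size does not; with a
  common count \<open>N\<close> for that size, the total is a product.\<close>

lemma card_words_Cons:
  assumes P: "P \<subseteq> {1..k}" and "0 \<notin> L" and A: "finite A" "card A = card P + card L"
    and N: "\<And>B. finite B \<Longrightarrow> card B = card L \<Longrightarrow> card (words B L I) = N"
  shows "card (words A (P \<union> (+) k ` L) (k # I)) = ((k + card L - 1 + of_bool (k \<in> P)) choose k) * N"
proof -
  have "card (words A (P \<union> (+) k ` L) (k # I)) =
      card (SIGMA v:rows A P k. words (A - (\<lambda>p. v ! (p - 1)) ` P) L I)"
    unfolding words_Cons[OF assms(1,2)]
    by (intro card_image) (auto simp: inj_on_def rows_def)
  also have "\<dots> = (\<Sum>v\<in>rows A P k. card (words (A - (\<lambda>p. v ! (p - 1)) ` P) L I))"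
    using A by (intro card_SigmaI) (auto simp: finite_rows finite_words)
  also have "\<dots> = (\<Sum>v\<in>rows A P k. N)"
  proof (intro sum.cong refl N)
    fix v assume v: "v \<in> rows A P k"
    then have "P \<subseteq> last_positions v" "set v \<subseteq> A" by (auto simp: rows_def)
    then have sub: "(\<lambda>p. v ! (p - 1)) ` P \<subseteq> A"
      using image_mono[OF \<open>P \<subseteq> last_positions v\<close>, of "\<lambda>p. v ! (p - 1)"]
      unfolding last_positions_image by blast
    have "card ((\<lambda>p. v ! (p - 1)) ` P) = card P"
      by (rule card_image[OF inj_on_subset[OF inj_on_last_positions \<open>P \<subseteq> last_positions v\<close>]])
    then show "card (A - (\<lambda>p. v ! (p - 1)) ` P) = card L"
      using A sub by (simp add: card_Diff_subset finite_subset)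
    show "finite (A - (\<lambda>p. v ! (p - 1)) ` P)" using A by simp
  qed
  also have "\<dots> = ((card A + k - 1 - card (P \<inter> {1..<k})) choose k) * N"
    using A P by (simp add: card_rows)
  \<comment> \<open>Subtracting from \<open>card P\<close> the elements below \<open>k\<close>
    leaves 1 or 0, according to whether \<open>k \<in> P\<close>.\<close>
  also have "card A + k - 1 - card (P \<inter> {1..<k}) = k + card L - 1 + of_bool (k \<in> P)"
  proof -
    have "finite P" using P finite_subset by blast
    have "P = (P \<inter> {1..<k}) \<union> (if k \<in> P then {k} else {})"
      using P by (auto simp: nat_less_le subset_iff)
    then have "card P = card ((P \<inter> {1..<k}) \<union> (if k \<in> P then {k} else {}))" by simp
    also have "\<dots> = card (P \<inter> {1..<k}) + of_bool (k \<in> P)"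
      using \<open>finite P\<close> by (subst card_Un_disjoint) auto
    finally have "card P = card (P \<inter> {1..<k}) + of_bool (k \<in> P)" .
    moreover have "k \<in> P \<Longrightarrow> k \<ge> 1" using P by auto
    ultimately show ?thesis using A by (auto simp: of_bool_def)
  qed
  finally show ?thesis .
qed

text \<open>The recursion sees the alphabet only through its size, so induction on \<open>I\<close>
  replaces a relabelling of letters.\<close>

lemma card_words_cong:
  assumes "finite A" "finite B" "card A = card B" "card A = card L" "finite L" "0 \<notin> L"
  shows "card (words A L I) = card (words B L I)"
  using assms
proof (induction I arbitrary: A B L)
  case Nil
  have "words A L [] = words B L []"
  proof (cases "L = {}")
    case True
    then show ?thesis using Nil by simp
  next
    case False
    then show ?thesis by (auto simp: words_def last_positions_Nil)
  qed
  then show ?case by simp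
next
  case (Cons k I)
  obtain P L' where L': "P \<subseteq> {1..k}" "finite L'" "0 \<notin> L'" "L = P \<union> (+) k ` L'"
    "card L = card P + card L'"
    using shifted_union_decomposition[OF Cons.prems(5,6)] by metis
  define N where "N = card (words {1..card L'} L' I)"
  have N: "card (words C L' I) = N" if "finite C" "card C = card L'" for C
    unfolding N_def using that L' by (intro Cons.IH) auto
  have "card (words C L (k # I)) = ((k + card L' - 1 + of_bool (k \<in> P)) choose k) * N"
    if "finite C" "card C = card L" for C
    unfolding L'(4) by (rule card_words_Cons) (use that L' N in auto)
  then show ?case
    using Cons.prems by metis
qed

section \<open>Products of complete functions as sums over packed words\<close>

text \<open>Both sides obey the same recursion in the first part: the coefficients of
  \<open>S_mult_Psi_set\<close> are the factors in \<open>card_words_Cons\<close>. Sets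
  \<open>L\<close> lacking a positive total contribute 0, since the final position of a word is
  always a last one.\<close>

lemma prod_list_S_eq_sum_words:
  "prod_list (map S I) = (\<Sum>L\<in>Pow {1..sum_list I}.
     of_nat (card (words {1..card L} L I)) * Psi_set L :: 'k::field_char_0 sym)"
proof (induction I)
  case Nil
  show ?case by (simp add: words_Nil Psi_set_empty)
next
  case (Cons k I)
  let ?m = "sum_list I"
  let ?c = "\<lambda>L P. (k + card L - 1 + of_bool (k \<in> P)) choose k"
  let ?w = "\<lambda>L I. card (words {1..card L} L I)"
  have "prod_list (map S (k # I)) = S k * (\<Sum>L\<in>Pow {1..?m}. of_nat (?w L I) * (Psi_set L :: 'k sym))"
    using Cons by simp
  also have "\<dots> = (\<Sum>L\<in>Pow {1..?m}. of_nat (?w L I) * (S k * Psi_set L))"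
    by (simp add: sum_distrib_left mult_of_nat_left_commute)
  also have "\<dots> = (\<Sum>L\<in>Pow {1..?m}. \<Sum>P\<in>Pow {1..k}.
      of_nat (?w (P \<union> (+) k ` L) (k # I)) * Psi_set (P \<union> (+) k ` L))"
  proof (intro sum.cong refl)
    fix L assume "L \<in> Pow {1..?m}"
    then have L: "finite L" "0 \<notin> L" by (auto intro: finite_subset)
    have "of_nat (?w L I) * (of_nat (?c L P) * Psi_set (P \<union> (+) k ` L)) =
        of_nat (?w (P \<union> (+) k ` L) (k # I)) * (Psi_set (P \<union> (+) k ` L) :: 'k sym)"
      if "P \<in> Pow {1..k}" for P
    proof -
      have "finite P" using that finite_subset by auto
      have card: "card (P \<union> (+) k ` L) = card P + card L"
        using that L \<open>finite P\<close> by (subst card_Un_disjoint) (auto simp: card_image)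
      have "?w (P \<union> (+) k ` L) (k # I) = ?c L P * ?w L I"
        unfolding card using that L
        by (intro card_words_Cons card_words_cong) auto
      then show ?thesis by (simp add: mult.assoc[symmetric] mult.commute)
    qed
    then show "of_nat (?w L I) * (S k * Psi_set L) = (\<Sum>P\<in>Pow {1..k}.
      of_nat (?w (P \<union> (+) k ` L) (k # I)) * (Psi_set (P \<union> (+) k ` L) :: 'k sym))"
      unfolding S_mult_Psi_set[OF L] sum_distrib_left by (intro sum.cong) auto
  qed
  also have "\<dots> = (\<Sum>(L, P)\<in>Pow {1..?m} \<times> Pow {1..k}.
      of_nat (?w (P \<union> (+) k ` L) (k # I)) * Psi_set (P \<union> (+) k ` L))"
    by (rule sum.cartesian_product)
  also have "\<dots> = (\<Sum>L\<in>Pow {1..sum_list (k # I)}. of_nat (?w L (k # I)) * Psi_set L)"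
  \<comment> \<open>The inverse cuts \<open>L\<close> after \<open>k\<close> and shifts the upper
    piece back.\<close>
  proof (rule sum.reindex_bij_witness[where
          i = "\<lambda>L. ({j \<in> {1..?m}. k + j \<in> L}, L \<inter> {1..k})" and j = "\<lambda>(L, P). P \<union> (+) k ` L"])
    fix L assume L: "L \<in> Pow {1..sum_list (k # I)}"
    have "x \<in> (+) k ` {j \<in> {1..?m}. k + j \<in> L}" if x: "x \<in> L" "x > k" for x
    proof -
      obtain j where "x = k + Suc j" using x by (auto simp: less_iff_Suc_add)
      then show ?thesis using x L by auto
    qed
    then show "(case ({j \<in> {1..?m}. k + j \<in> L}, L \<inter> {1..k}) of (L, P) \<Rightarrow> P \<union> (+) k ` L) = L"
      using L by fastforce
  qed auto
  finally show ?case .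
qed

text \<open>The number of letters is the number of last positions, so fixing the latter fixes the
  alphabet of a packed word.\<close>

lemma packed_iff: "packed u \<longleftrightarrow> set u = {1..card (last_positions u)}"
  unfolding packed_def card_last_positions
proof
  assume "\<exists>r. set u = {1..r}"
  then obtain r where "set u = {1..r}" ..
  then show "set u = {1..card (set u)}" by simp
qed (rule exI)

definition packed_words :: "nat \<Rightarrow> nat list set" where
  "packed_words n = {u. packed u \<and> length u = n}"

lemma S_comp_eq_sum_packed_words:
  assumes "weight J = n"
  shows "S_comp J = (\<Sum>u | u \<in> packed_words n \<and> descents u \<subseteq> psums (parts J).
     Psi_set (last_positions u) :: 'k::field_char_0 sym)"
proof -
  let ?U = "{u. u \<in> packed_words n \<and> descents u \<subseteq> psums (parts J)}"
  have "(\<Sum>u\<in>?U. Psi_set (last_positions u)) =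
     (\<Sum>L\<in>Pow {1..n}. \<Sum>u | u \<in> ?U \<and> last_positions u = L. Psi_set (last_positions u) :: 'k sym)"
    using last_positions_subset
    by (intro sum.group[symmetric]) (auto simp: packed_words_def intro: finite_subset[OF _ finite_packed_words[of n]])
  also have "\<dots> = (\<Sum>L\<in>Pow {1..n}. of_nat (card (words {1..card L} L (parts J))) * Psi_set L)"
  proof (intro sum.cong refl)
    fix L
    have "{u. u \<in> ?U \<and> last_positions u = L} = words {1..card L} L (parts J)"
      using assms by (auto simp: words_def packed_words_def packed_iff weight_def)
    then show "(\<Sum>u | u \<in> ?U \<and> last_positions u = L. Psi_set (last_positions u)) =
        of_nat (card (words {1..card L} L (parts J))) * (Psi_set L :: 'k sym)"
      by (simp add: words_def)
  qed
  finally show ?thesis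
    using assms unfolding S_comp_def prod_list_S_eq_sum_words by (simp add: weight_def)
qed

section \<open>Coarsening and inclusion-exclusion\<close>

lemma psums_append: "psums (xs @ ys) = psums xs \<union> (+) (sum_list xs) ` psums ys"
  by (induction xs) (auto simp: psums_Cons psums_Nil image_Un image_image add.assoc)

lemma psums_le_sum_list: "x \<in> psums xs \<Longrightarrow> x \<le> sum_list xs"
  by (induction xs arbitrary: x) (auto simp: psums_Cons psums_Nil)

lemma psums_butlast: "0 \<notin> set xs \<Longrightarrow> psums (butlast xs) = psums xs - {sum_list xs}"
  by (cases xs rule: rev_cases) (auto simp: psums_Nil psums_snoc dest: psums_le_sum_list)

text \<open>Merging consecutive parts deletes partial sums and keeps the total. Conversely, the
  first part of \<open>J\<close> is the sum of a prefix of \<open>I\<close>; that prefix is the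
  first block, and the rest follows by induction.\<close>

lemma coarser_iff: "coarser J I \<longleftrightarrow> weight J = weight I \<and> psums (parts J) \<subseteq> psums (parts I)"
proof
  assume "coarser J I"
  then obtain xss where xss: "[] \<notin> set xss" "concat xss = parts I" "map sum_list xss = parts J"
    by (auto simp: coarser_def)
  have "sum_list (map sum_list xss) = sum_list (concat xss)" for xss :: "nat list list"
    by (induction xss) auto
  moreover have "psums (map sum_list xss) \<subseteq> psums (concat xss)" if "[] \<notin> set xss" for xss :: "nat list list"
    using that
  proof (induction xss)
    case (Cons xs xss)
    then obtain ys y where "xs = ys @ [y]" by (cases xs rule: rev_cases) auto
    then have "sum_list xs \<in> psums xs" by (simp add: psums_snoc)
    then show ?case using Cons by (auto simp: psums_Cons psums_append)
  qed (simp add: psums_Nil)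
  ultimately show "weight J = weight I \<and> psums (parts J) \<subseteq> psums (parts I)"
    using xss by (metis weight_def)
next
  assume *: "weight J = weight I \<and> psums (parts J) \<subseteq> psums (parts I)"
  have "\<exists>xss. [] \<notin> set xss \<and> concat xss = xs \<and> map sum_list xss = ys"
    if "0 \<notin> set xs" "0 \<notin> set ys" "sum_list ys = sum_list xs" "psums ys \<subseteq> psums xs" for xs ys :: "nat list"
    using that
  proof (induction ys arbitrary: xs)
    case Nil
    then show ?case by (cases xs) (auto intro!: exI[of _ "[]"])
  next
    case (Cons y ys)
    then obtain j where j: "y = sum_list (take j xs)" "1 \<le> j" "j \<le> length xs"
      by (auto simp: psums_Cons psums_def)
    define zs ws where "zs = take j xs" and "ws = drop j xs"
    have xs: "xs = zs @ ws" "y = sum_list zs" "zs \<noteq> []"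
      using j by (auto simp: zs_def ws_def)
    have "psums ys \<subseteq> psums ws"
    proof
      fix p assume p: "p \<in> psums ys"
      then have "y + p \<in> psums zs \<union> (+) y ` psums ws"
        using Cons.prems(4) xs by (auto simp: psums_Cons psums_append)
      \<comment> \<open>As \<open>p\<close> is positive, \<open>y + p\<close> exceeds the total of
        \<open>zs\<close>, so it must come from \<open>ws\<close>.\<close>
      moreover have "p \<noteq> 0" using p psums_pos[of ys] Cons.prems(2) by (metis list.set_intros(2))
      then have "y + p \<notin> psums zs" using psums_le_sum_list[of "y + p" zs] xs(2) by auto
      ultimately show "p \<in> psums ws" by auto
    qed
    then obtain xss where "[] \<notin> set xss" "concat xss = ws" "map sum_list xss = ys"
      using Cons.IH[of ws] Cons.prems xs by auto
    then show ?case using xs by (intro exI[of _ "zs # xss"]) auto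
  qed
  then show "coarser J I"
    using * parts[of I] parts[of J] by (simp add: coarser_def weight_def)
qed

text \<open>Turns the sum over coarser compositions into one over a Boolean lattice; the total is
  removed because all of them share it.\<close>

lemma bij_betw_coarser:
  "bij_betw (\<lambda>J. psums (parts J) - {weight I}) {J. coarser J I} (Pow (psums (parts I) - {weight I}))"
proof (rule bij_betw_imageI)
  have total: "psums (parts J) = (if n = 0 then {} else insert n (psums (parts J) - {n}))"
    if "weight J = n" for J n
  proof (cases "parts J" rule: rev_cases)
    case Nil
    then show ?thesis using that by (simp add: weight_def psums_Nil)
  next
    case (snoc xs x)
    then show ?thesis using that parts[of J] by (auto simp: weight_def psums_snoc)
  qed
  show "inj_on (\<lambda>J. psums (parts J) - {weight I}) {J. coarser J I}"
  proof (rule inj_onI)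
    fix J J' assume J: "J \<in> {J. coarser J I}" "J' \<in> {J. coarser J I}"
      and eq: "psums (parts J) - {weight I} = psums (parts J') - {weight I}"
    have "weight J = weight I" "weight J' = weight I" using J by (auto simp: coarser_iff)
    then have "psums (parts J) = psums (parts J')"
      using total eq by metis
    then show "J = J'"
      using psums_inj[of "parts J" "parts J'"] parts[of J] parts[of J'] by (simp add: parts_inject)
  qed
  show "(\<lambda>J. psums (parts J) - {weight I}) ` {J. coarser J I} = Pow (psums (parts I) - {weight I})"
  proof (intro set_eqI iffI)
    fix T assume "T \<in> (\<lambda>J. psums (parts J) - {weight I}) ` {J. coarser J I}"
    then show "T \<in> Pow (psums (parts I) - {weight I})" by (auto simp: coarser_iff)
  next
    fix T assume T: "T \<in> Pow (psums (parts I) - {weight I})"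
    \<comment> \<open>The total is put back, except in weight 0, where the empty composition has no
      partial sums.\<close>
    define A where "A = (if weight I = 0 then {} else insert (weight I) T)"
    have sub: "psums (parts I) \<subseteq> {1..weight I}"
      using psums_pos[of "parts I"] parts[of I] psums_le_sum_list[of _ "parts I"]
      by (force simp: weight_def Suc_le_eq intro: gr0I)
    then have TI: "T \<subseteq> {1..<weight I}" using T by fastforce
    then have "finite T" by (rule finite_subset) simp
    then have "finite A" "0 \<notin> A" using TI by (auto simp: A_def)
    moreover have "Max (insert 0 A) = weight I"
      using \<open>finite T\<close> TI by (intro Max_eqI) (auto simp: A_def split: if_splits)
    ultimately obtain xs where xs: "0 \<notin> set xs" "psums xs = A" "sum_list xs = weight I"
      using psums_exists by metis
    have "A \<subseteq> psums (parts I)"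
      using T total[of I "weight I"] by (auto simp: A_def split: if_splits)
    then have "coarser (Composition xs) I"
      using xs by (simp add: coarser_iff weight_def Composition_inverse)
    moreover have "psums (parts (Composition xs)) - {weight I} = T"
      using xs TI by (auto simp: Composition_inverse A_def)
    ultimately show "T \<in> (\<lambda>J. psums (parts J) - {weight I}) ` {J. coarser J I}" by force
  qed
qed

text \<open>With \<open>Y = T - X\<close> the sum is the expansion of the product of
  \<open>1 - 1\<close> over \<open>Q - X\<close>, which is 1 only if that set is empty.\<close>

lemma sum_alternating_between:
  assumes "finite Q"
  shows "(\<Sum>T | T \<in> Pow Q \<and> X \<subseteq> T. (-1) ^ (card Q - card T)) = (of_bool (X = Q) :: 'a::comm_ring_1)"
proof (cases "X \<subseteq> Q")
  case True
  have "(\<Sum>T | T \<in> Pow Q \<and> X \<subseteq> T. (-1) ^ (card Q - card T)) =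
      (\<Sum>Y\<in>Pow (Q - X). (-1) ^ (card (Q - X) - card Y) :: 'a)"
  proof (rule sum.reindex_bij_witness[where i = "\<lambda>Y. X \<union> Y" and j = "\<lambda>T. T - X"])
    fix T assume T: "T \<in> {T. T \<in> Pow Q \<and> X \<subseteq> T}"
    have "finite X" "finite T" using T assms True finite_subset by auto
    then show "(-1) ^ (card (Q - X) - card (T - X)) = ((-1) ^ (card Q - card T) :: 'a)"
      using T True card_mono[of T X] by (simp add: card_Diff_subset)
  qed (use True in auto)
  also have "\<dots> = (\<Prod>x\<in>Q - X. 1 - 1)"
    using assms by (subst prod_diff_conv_sum') auto
  also have "\<dots> = of_bool (X = Q)"
  proof (cases "X = Q")
    case False
    then have "card (Q - X) \<noteq> 0" using assms True by auto
    then show ?thesis using False by (simp add: power_0_left)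
  qed simp
  finally show ?thesis .
next
  case False
  then have empty: "{T. T \<in> Pow Q \<and> X \<subseteq> T} = {}" and "X \<noteq> Q" by auto
  then show ?thesis unfolding empty by simp
qed

section \<open>Ribbons as sums over packed words\<close>

lemma D_eq_iff: "D u = I \<longleftrightarrow> length u = weight I \<and> descents u = psums (parts I) - {weight I}"
proof -
  have D: "D u = I \<longleftrightarrow> I \<in> compositions (length u) \<and> proper_partial_sums I = descents u"
  proof
    assume "D u = I"
    then show "I \<in> compositions (length u) \<and> proper_partial_sums I = descents u"
      using theI'[OF ex1_D[of u]] unfolding D_def by simp
  next
    assume "I \<in> compositions (length u) \<and> proper_partial_sums I = descents u"
    then show "D u = I"
      unfolding D_def by (rule the1_equality[OF ex1_D])
  qed
  have pps: "proper_partial_sums I = psums (parts I) - {weight I}"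
    using psums_butlast[of "parts I"] parts[of I] by (simp add: proper_partial_sums_eq weight_def)
  show ?thesis
    unfolding D pps compositions_def mem_Collect_eq
    by (rule iffI; elim conjE; intro conjI; erule sym)
qed

lemma weight_WC: "weight (WC u) = length u"
  using theI'[OF ex1_WC[of u]] unfolding WC_def compositions_def by simp

lemma Psi_WC: "Psi (WC u) = (Psi_set (last_positions u) :: 'k::field_char_0 sym)"
proof -
  have "partial_sums (WC u) = last_positions u"
    using theI'[OF ex1_WC[of u]] unfolding WC_def by simp
  then show ?thesis
    using Psi_set_psums[of "parts (WC u)", where 'k = 'k] parts[of "WC u"]
    by (simp add: partial_sums_eq Psi_def)
qed

text \<open>After exchanging the sums, a word carries the alternating sum over all sets between its
  descents and \<open>?Q\<close>, which keeps it only if the two coincide.\<close>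

lemma ribbon_eq_sum_packed_words:
  "ribbon I = (\<Sum>u | u \<in> packed_words (weight I) \<and> D u = I. Psi (WC u) :: 'k::field_char_0 sym)"
proof -
  let ?n = "weight I"
  let ?U = "packed_words ?n" and ?Q = "psums (parts I) - {?n}"
  let ?T = "\<lambda>J. psums (parts J) - {?n}"
  let ?f = "\<lambda>T. \<Sum>u | u \<in> ?U \<and> descents u \<subseteq> T. (-1) ^ (card ?Q - card T) * (Psi (WC u) :: 'k sym)"
  have finU: "finite ?U" unfolding packed_words_def by (rule finite_packed_words)
  have "ribbon I = (\<Sum>J | coarser J I. ?f (?T J))"
    unfolding ribbon_def
  proof (intro sum.cong refl)
    fix J assume "J \<in> {J. coarser J I}"
    then have J: "weight J = ?n" by (simp add: coarser_iff)
    have card: "card (?T J) = len J - 1" if "weight J = ?n" for J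
    proof -
      have "?T J = psums (butlast (parts J))"
        using psums_butlast[of "parts J"] parts[of J] that by (simp add: weight_def)
      moreover have "0 \<notin> set (butlast (parts J))"
        using parts[of J] by (auto dest: in_set_butlastD)
      ultimately show ?thesis by (simp add: card_psums len_def)
    qed
    \<comment> \<open>With truncated subtraction, the ones in \<open>len I - 1\<close> and
      \<open>len J - 1\<close> cancel only if both lengths are positive or both are 0.\<close>
    have "len J = 0 \<longleftrightarrow> weight J = 0" for J
      using length_le_sum_list[of "parts J"] parts[of J]
      by (auto simp: len_def weight_def simp del: sum_list_eq_0_iff)
    then have "len J = 0 \<longleftrightarrow> len I = 0" using J by simp
    then have "card ?Q - card (?T J) = len I - len J"
      using card[OF J] card[of I] by auto
    \<comment> \<open>Descents lie strictly below the length, so dropping the total does not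
      matter.\<close>
    moreover have "{u. u \<in> ?U \<and> descents u \<subseteq> psums (parts J)} = {u. u \<in> ?U \<and> descents u \<subseteq> ?T J}"
      by (auto simp: packed_words_def descents_def)
    ultimately show "(-1) ^ (len I - len J) * S_comp J = ?f (?T J)"
      by (simp add: S_comp_eq_sum_packed_words[OF J] sum_distrib_left Psi_WC)
  qed
  also have "\<dots> = (\<Sum>T\<in>Pow ?Q. ?f T)"
    by (rule sum.reindex_bij_betw[OF bij_betw_coarser])
  also have "\<dots> = (\<Sum>u\<in>?U. \<Sum>T | T \<in> Pow ?Q \<and> descents u \<subseteq> T.
      (-1) ^ (card ?Q - card T) * (Psi (WC u) :: 'k sym))"
    using finU by (intro sum.swap_restrict) (auto simp: finite_psums)
  also have "\<dots> = (\<Sum>u\<in>?U. if D u = I then Psi (WC u) else 0)"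
  proof (intro sum.cong refl)
    fix u assume "u \<in> ?U"
    then have "D u = I \<longleftrightarrow> descents u = ?Q" by (simp add: D_eq_iff packed_words_def)
    moreover have "(\<Sum>T | T \<in> Pow ?Q \<and> descents u \<subseteq> T. (-1) ^ (card ?Q - card T))
        = (of_bool (descents u = ?Q) :: 'k sym)"
    proof -
      \<comment> \<open>The identity is taken over the integers and mapped into the algebra, which
        is not a commutative ring as its lemma requires.\<close>
      have "of_int (\<Sum>T | T \<in> Pow ?Q \<and> descents u \<subseteq> T. (-1) ^ (card ?Q - card T))
          = (of_int (of_bool (descents u = ?Q)) :: 'k sym)"
        using sum_alternating_between[of ?Q "descents u", where 'a = int] by (simp add: finite_psums)
      then show ?thesis by simp
    qed
    ultimately show "(\<Sum>T | T \<in> Pow ?Q \<and> descents u \<subseteq> T.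
      (-1) ^ (card ?Q - card T) * (Psi (WC u) :: 'k sym)) = (if D u = I then Psi (WC u) else 0)"
      by (simp add: sum_distrib_right[symmetric])
  qed
  also have "\<dots> = (\<Sum>u | u \<in> ?U \<and> D u = I. Psi (WC u))"
    using finU by (simp add: sum.inter_filter[symmetric] cong: rev_conj_cong)
  finally show ?thesis .
qed

theorem theorem6p4:
  fixes n :: nat and I :: composition
  assumes "I \<in> compositions n"
  shows "ribbon I = (\<Sum>J\<in>compositions n. of_nat (K I J) * Psi J :: 'k::field_char_0 sym) \<and>
         (\<forall>J\<in>compositions n. (of_nat (K I J) :: 'k) \<in> \<nat>)"
proof
  have n: "weight I = n" using assms by (simp add: compositions_def)
  let ?V = "{u. u \<in> packed_words n \<and> D u = I}"
  have "ribbon I = (\<Sum>u\<in>?V. Psi (WC u) :: 'k sym)"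
    using ribbon_eq_sum_packed_words[of I, where 'k = 'k] n by simp
  \<comment> \<open>Group the words by W-composition; the class sizes are the numbers
    \<open>K I J\<close>.\<close>
  also have "\<dots> = (\<Sum>J\<in>compositions n. \<Sum>u | u \<in> ?V \<and> WC u = J. Psi (WC u))"
    by (intro sum.group[symmetric] finite_compositions)
      (auto simp: packed_words_def compositions_def weight_WC
        intro: finite_subset[OF _ finite_packed_words[of n]])
  also have "\<dots> = (\<Sum>J\<in>compositions n. of_nat (K I J) * Psi J)"
  proof (intro sum.cong refl)
    fix J
    have "{u. u \<in> ?V \<and> WC u = J} = {u. packed u \<and> length u = weight I \<and> D u = I \<and> WC u = J}"
      by (auto simp: packed_words_def n)
    then show "(\<Sum>u | u \<in> ?V \<and> WC u = J. Psi (WC u)) = of_nat (K I J) * (Psi J :: 'k sym)"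
      by (simp add: K_def)
  qed
  finally show "ribbon I = (\<Sum>J\<in>compositions n. of_nat (K I J) * Psi J :: 'k sym)" .
qed simp

end
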